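(* Let $\Phi$ be a unital commutative ring which is 2- and 3-torsion free, let $G$ be an abelian group, and let $Q=\bigoplus_{\sigma\in G}Q_\sigma$ be a $G$-graded Lie algebra over $\Phi$ which is a graded weak algebra of quotients of a graded subalgebra $L$ of $Q$. If $L$ is graded strongly nondegenerate, then $Q$ is graded strongly nondegenerate.
   Context: Lie algebras are over the ring of scalars $\Phi$. A Lie algebra $L$ is $G$-graded if $L=\bigoplus_{\sigma\in G}L_\sigma$ with $L_\sigma$ $\Phi$-submodules and $[L_\sigma,L_\tau]\subseteq L_{\sigma\tau}$. A graded subalgebra $L$ of $Q$ is a subalgebra with $L=\bigoplus_\sigma L_\sigma$, $L_\sigma=L\cap Q_\sigma$. Homogeneous elements are the elements of $\bigcup_\sigma L_\sigma$. $Q$ is a graded weak algebra of quotients of a graded subalgebra $L$ if for every $\sigma\in G$ and every $0\neq p_\sigma\in Q_\sigma$ there exist $\alpha\in G$ and $x_\alpha\in L_\alpha$ with $0\neq[x_\alpha,p_\sigma]\in L$. A homogeneous element $x$ of a graded Lie algebra $L$ is a homogeneous absolute zero divisor if $(\mathrm{ad}\,x)^2=0$ on $L$, where $\mathrm{ad}\,x(y)=[x,y]$. $L$ is graded strongly nondegenerate if it has no nonzero homogeneous absolute zero divisors.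
   Formalization: The torsion assumption is also imposed on Q as a Φ-module (2q=0 or 3q=0 implies q=0), not only on the ring Φ; without it the claim fails, e.g. Φ=ℤ, L=F₂(t)³ with cross product, Q=L⊕F₂p with p acting as d/dt. *)

theory Defs
  imports Complex_Main
begin

locale lie_algebra = module scale
  for scale :: "'k::comm_ring_1 \<Rightarrow> 'q::ab_group_add \<Rightarrow> 'q" +
  fixes bracket :: "'q \<Rightarrow> 'q \<Rightarrow> 'q"
  assumes bracket_add_left: "bracket (x + y) z = bracket x z + bracket y z"
    and bracket_add_right: "bracket x (y + z) = bracket x y + bracket x z"
    and bracket_scale_left: "bracket (scale a x) y = scale a (bracket x y)"
    and bracket_scale_right: "bracket x (scale a y) = scale a (bracket x y)"
    and bracket_self: "bracket x x = 0"
    and jacobi: "bracket x (bracket y z) + bracket y (bracket z x) + bracket z (bracket x y) = 0"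

definition lie_subalgebra ::
  "('k::comm_ring_1 \<Rightarrow> 'q::ab_group_add \<Rightarrow> 'q) \<Rightarrow> ('q \<Rightarrow> 'q \<Rightarrow> 'q) \<Rightarrow> 'q set \<Rightarrow> bool" where
  "lie_subalgebra scale bracket L \<longleftrightarrow>
     module.subspace scale L \<and> (\<forall>x\<in>L. \<forall>y\<in>L. bracket x y \<in> L)"

(* Internal direct sum, M = \<Oplus>\<sigma>. A \<sigma> over a possibly infinite index type: the members of M are
   exactly the sums of finitely supported families, and each arises from only one family. *)
definition is_direct_sum :: "'q::ab_group_add set \<Rightarrow> ('g \<Rightarrow> 'q set) \<Rightarrow> bool" where
  "is_direct_sum M A \<longleftrightarrow>
     (\<forall>f. (\<forall>\<sigma>. f \<sigma> \<in> A \<sigma>) \<and> finite {\<sigma>. f \<sigma> \<noteq> 0} \<longrightarrow> (\<Sum>\<sigma> | f \<sigma> \<noteq> 0. f \<sigma>) \<in> M) \<and>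
     (\<forall>x\<in>M. \<exists>!f. (\<forall>\<sigma>. f \<sigma> \<in> A \<sigma>) \<and> finite {\<sigma>. f \<sigma> \<noteq> 0} \<and> x = (\<Sum>\<sigma> | f \<sigma> \<noteq> 0. f \<sigma>))"

(* The grading group is written additively. *)
definition lie_grading ::
  "('k::comm_ring_1 \<Rightarrow> 'q::ab_group_add \<Rightarrow> 'q) \<Rightarrow> ('q \<Rightarrow> 'q \<Rightarrow> 'q) \<Rightarrow> 'q set
     \<Rightarrow> ('g::ab_group_add \<Rightarrow> 'q set) \<Rightarrow> bool" where
  "lie_grading scale bracket L A \<longleftrightarrow>
     (\<forall>\<sigma>. module.subspace scale (A \<sigma>)) \<and>
     is_direct_sum L A \<and>
     (\<forall>\<sigma> \<tau>. \<forall>x\<in>A \<sigma>. \<forall>y\<in>A \<tau>. bracket x y \<in> A (\<sigma> + \<tau>))"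

definition graded_subalgebra ::
  "('k::comm_ring_1 \<Rightarrow> 'q::ab_group_add \<Rightarrow> 'q) \<Rightarrow> ('q \<Rightarrow> 'q \<Rightarrow> 'q) \<Rightarrow> ('g::ab_group_add \<Rightarrow> 'q set)
     \<Rightarrow> 'q set \<Rightarrow> bool" where
  "graded_subalgebra scale bracket A L \<longleftrightarrow>
     lie_subalgebra scale bracket L \<and> is_direct_sum L (\<lambda>\<sigma>. L \<inter> A \<sigma>)"

definition graded_weak_algebra_of_quotients ::
  "('q::ab_group_add \<Rightarrow> 'q \<Rightarrow> 'q) \<Rightarrow> ('g \<Rightarrow> 'q set) \<Rightarrow> 'q set \<Rightarrow> bool" where
  "graded_weak_algebra_of_quotients bracket A L \<longleftrightarrow>
     (\<forall>\<sigma>. \<forall>p\<in>A \<sigma>. p \<noteq> 0 \<longrightarrow>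
        (\<exists>\<alpha>. \<exists>x\<in>L \<inter> A \<alpha>. bracket x p \<noteq> 0 \<and> bracket x p \<in> L))"

definition homogeneous_elements :: "('g \<Rightarrow> 'q set) \<Rightarrow> 'q set" where
  "homogeneous_elements A = (\<Union>\<sigma>. A \<sigma>)"

definition homogeneous_absolute_zero_divisor ::
  "('q::ab_group_add \<Rightarrow> 'q \<Rightarrow> 'q) \<Rightarrow> 'q set \<Rightarrow> ('g \<Rightarrow> 'q set) \<Rightarrow> 'q \<Rightarrow> bool" where
  "homogeneous_absolute_zero_divisor bracket L A x \<longleftrightarrow>
     x \<in> homogeneous_elements A \<and> (\<forall>y\<in>L. bracket x (bracket x y) = 0)"

definition graded_strongly_nondegenerate ::
  "('q::ab_group_add \<Rightarrow> 'q \<Rightarrow> 'q) \<Rightarrow> 'q set \<Rightarrow> ('g \<Rightarrow> 'q set) \<Rightarrow> bool" where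
  "graded_strongly_nondegenerate bracket L A \<longleftrightarrow>
     (\<nexists>x. x \<noteq> 0 \<and> homogeneous_absolute_zero_divisor bracket L A x)"

end

(* Let p be a homogeneous absolute zero divisor of Q and P = ad p, so that P^2 = 0 and P X P = 0
   for every X = ad x. The expression [p,[x,[y,[u,p]]]] is then symmetric in x, y, u, and inserting
   an element of the form [u,[v,[p,w]]] into it yields a linear relation (quintic_identity) between
   the ten elements [p,[x,[y,[p,[u,[v,[w,p]]]]]]] obtained by distributing five letters.
   If p is nonzero, choose a homogeneous x in L such that y = [x,p] is a nonzero element of L.
   Since (ad y)^2 = - P X^2 P, the relations give:
   (P X^2 P)^2 = 0, hence [y,[y,x]] is an absolute zero divisor, lies in L, and vanishes;
   thereupon P X^2 P X U P = 0 = P X U P X^2 P, hence [y,[y,u]] is an absolute zero divisor and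
   vanishes for every homogeneous u in L. So y is an absolute zero divisor of L. *)
theory Submission
  imports Defs
begin

context lie_algebra
begin

notation bracket (infixr "\<bullet>" 80)

lemma bracket_zero_left [simp]: "0 \<bullet> x = 0"
  using bracket_add_left[of 0 0 x] by simp

lemma bracket_zero_right [simp]: "x \<bullet> 0 = 0"
  using bracket_add_right[of x 0 0] by simp

lemma bracket_minus_left: "(- x) \<bullet> y = - (x \<bullet> y)"
  using bracket_add_left[of x "- x" y] by (simp add: eq_neg_iff_add_eq_0 add.commute)

lemma bracket_minus_right: "x \<bullet> (- y) = - (x \<bullet> y)"
  using bracket_add_right[of x y "- y"] by (simp add: eq_neg_iff_add_eq_0 add.commute)

lemma bracket_diff_left: "(x - y) \<bullet> z = x \<bullet> z - y \<bullet> z"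
  by (simp only: diff_conv_add_uminus bracket_add_left bracket_minus_left)

lemma bracket_diff_right: "x \<bullet> (y - z) = x \<bullet> y - x \<bullet> z"
  by (simp only: diff_conv_add_uminus bracket_add_right bracket_minus_right)

lemma bracket_sum_right: "x \<bullet> (\<Sum>i\<in>I. f i) = (\<Sum>i\<in>I. x \<bullet> f i)"
  by (induction I rule: infinite_finite_induct) (simp_all add: bracket_add_right)

lemmas bracket_linear =
  bracket_add_left bracket_add_right bracket_minus_left bracket_minus_right
  bracket_diff_left bracket_diff_right

lemma bracket_anticommute: "x \<bullet> y = - (y \<bullet> x)"
proof -
  have "x \<bullet> y + y \<bullet> x = (x + y) \<bullet> (x + y)"
    by (simp only: bracket_add_left bracket_add_right bracket_self[of x] bracket_self[of y]
        add_0_left add_0_right add.commute)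
  then show ?thesis
    by (metis bracket_self eq_neg_iff_add_eq_0)
qed

text \<open>The Jacobi identity as ad [x,y] = XY - YX. Used as a rewrite rule, it turns any bracket
  into right-nested words, that is, products of operators.\<close>

lemma bracket_bracket_left: "(x \<bullet> y) \<bullet> z = x \<bullet> y \<bullet> z - y \<bullet> x \<bullet> z"
  using jacobi[of x y z] bracket_anticommute[of z "x \<bullet> y"] bracket_anticommute[of z x]
  by (simp add: bracket_linear algebra_simps)

end

locale lie_absolute_zero_divisor = lie_algebra scale bracket
  for scale :: "'k::comm_ring_1 \<Rightarrow> 'q::ab_group_add \<Rightarrow> 'q" and bracket +
  fixes p :: 'q
  assumes absolute_zero_divisor: "p \<bullet> p \<bullet> v = 0"
    and torsion_free_2: "scale 2 (q :: 'q) = 0 \<Longrightarrow> q = 0"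
    and torsion_free_3: "scale 3 (q :: 'q) = 0 \<Longrightarrow> q = 0"
begin

lemma double_eq_0D: "q + q = 0 \<Longrightarrow> q = 0" for q :: 'q
  using torsion_free_2[of q] scale_left_distrib[of 1 1 q] by simp

lemma triple_eq_0D: "q + q + q = 0 \<Longrightarrow> q = 0" for q :: 'q
  using torsion_free_3[of q] scale_left_distrib[of 1 1 q] scale_left_distrib[of 2 1 q] by simp

text \<open>Because P^2 = 0, the expansion of ad [p,[p,x]] = 0 reduces to -2 PXP, and 2
  cancels.\<close>

lemma sandwich: "p \<bullet> x \<bullet> p \<bullet> v = 0"
proof -
  have "(p \<bullet> p \<bullet> x) \<bullet> v = - (p \<bullet> x \<bullet> p \<bullet> v + p \<bullet> x \<bullet> p \<bullet> v)"
    unfolding bracket_bracket_left by (simp add: absolute_zero_divisor bracket_linear)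
  then have "p \<bullet> x \<bullet> p \<bullet> v + p \<bullet> x \<bullet> p \<bullet> v = 0"
    unfolding absolute_zero_divisor bracket_zero_left by (metis neg_equal_0_iff_equal)
  then show ?thesis by (rule double_eq_0D)
qed

lemma sandwich': "p \<bullet> x \<bullet> y \<bullet> p = 0"
  using sandwich[of x y] bracket_anticommute[of p y] by (simp add: bracket_linear)

lemma sandwich_commute: "p \<bullet> x \<bullet> y \<bullet> p \<bullet> v = p \<bullet> y \<bullet> x \<bullet> p \<bullet> v"
  using sandwich[of "x \<bullet> y" v] by (simp add: bracket_bracket_left bracket_linear)

text \<open>Putting a commutator into \<open>sandwich'\<close> swaps two neighbouring letters;
  together with \<open>triple_commute_right\<close> this generates all permutations of the
  three.\<close>

lemma triple_commute_left: "p \<bullet> x \<bullet> y \<bullet> u \<bullet> p = p \<bullet> y \<bullet> x \<bullet> u \<bullet> p"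
  using sandwich'[of "x \<bullet> y" u] by (simp add: bracket_bracket_left bracket_linear)

lemma triple_commute_right: "p \<bullet> x \<bullet> y \<bullet> u \<bullet> p = p \<bullet> x \<bullet> u \<bullet> y \<bullet> p"
  using sandwich'[of x "y \<bullet> u"] by (simp add: bracket_bracket_left bracket_linear)

text \<open>Frees the last letter, so that relations between elements ending in \<open>p\<close>
  become relations between operators.\<close>

lemma triple_as_operator: "p \<bullet> x \<bullet> y \<bullet> u \<bullet> p = - (p \<bullet> x \<bullet> y \<bullet> p \<bullet> u)"
  using bracket_anticommute[of u p] by (simp add: bracket_linear)

lemma quintic_identity:
  "p \<bullet> x \<bullet> y \<bullet> p \<bullet> u \<bullet> v \<bullet> w \<bullet> p =
     p \<bullet> u \<bullet> v \<bullet> p \<bullet> w \<bullet> x \<bullet> y \<bullet> p + p \<bullet> u \<bullet> w \<bullet> p \<bullet> v \<bullet> x \<bullet> y \<bullet> p +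
     p \<bullet> v \<bullet> w \<bullet> p \<bullet> u \<bullet> x \<bullet> y \<bullet> p"
proof -
  \<comment> \<open>By the symmetry of the cubic form, \<open>?q\<close> may be moved next to the outer \<open>p\<close>, where most
    terms of the expansion of \<open>ad ?q\<close> vanish.\<close>
  let ?q = "u \<bullet> v \<bullet> p \<bullet> w"
  have "?q \<bullet> p = p \<bullet> u \<bullet> v \<bullet> w \<bullet> p"
    using bracket_anticommute[of ?q p] bracket_anticommute[of p w] by (simp add: bracket_linear)
  then have "p \<bullet> x \<bullet> y \<bullet> p \<bullet> u \<bullet> v \<bullet> w \<bullet> p = p \<bullet> x \<bullet> y \<bullet> ?q \<bullet> p" by simp
  also have "\<dots> = p \<bullet> ?q \<bullet> x \<bullet> y \<bullet> p"
    by (metis triple_commute_left triple_commute_right)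
  also have "\<dots> = p \<bullet> u \<bullet> v \<bullet> p \<bullet> w \<bullet> x \<bullet> y \<bullet> p + p \<bullet> u \<bullet> w \<bullet> p \<bullet> v \<bullet> x \<bullet> y \<bullet> p +
     p \<bullet> v \<bullet> w \<bullet> p \<bullet> u \<bullet> x \<bullet> y \<bullet> p"
    by (simp add: bracket_bracket_left bracket_linear absolute_zero_divisor sandwich sandwich'
        algebra_simps)
  finally show ?thesis .
qed

text \<open>For the letters x, x, x, x, w there are only two distributions, and
  \<open>quintic_identity\<close> reads \<open>?b = ?b + 2 ?a\<close> and
  \<open>?a = 3 ?b\<close>.\<close>

lemma square_operator_square: "p \<bullet> x \<bullet> x \<bullet> p \<bullet> x \<bullet> x \<bullet> p \<bullet> w = 0"
proof -
  let ?a = "p \<bullet> x \<bullet> w \<bullet> p \<bullet> x \<bullet> x \<bullet> x \<bullet> p"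
    and ?b = "p \<bullet> x \<bullet> x \<bullet> p \<bullet> x \<bullet> x \<bullet> w \<bullet> p"
  have "?b = ?b + ?a + ?a"
    using quintic_identity[of x x x x w]
    by (simp add: add.assoc triple_commute_left[of w x x] triple_commute_right[of x w x])
  then have "?a = 0"
    using double_eq_0D[of ?a] by (simp add: add.assoc)
  moreover have "?a = ?b + ?b + ?b"
    using quintic_identity[of x w x x x]
    by (simp add: triple_commute_right[of x w x] triple_commute_left[of w x x])
  ultimately have "?b = 0"
    using triple_eq_0D[of ?b] by simp
  then show ?thesis
    by (simp add: triple_as_operator bracket_linear)
qed

text \<open>In (XP - PX)^2 only -PX^2P contains neither P^2 nor PXP.\<close>

lemma bracket_bracket_square:
  "(x \<bullet> p) \<bullet> (x \<bullet> p) \<bullet> v = - (p \<bullet> x \<bullet> x \<bullet> p \<bullet> v)"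
  by (simp add: bracket_bracket_left bracket_linear absolute_zero_divisor sandwich)

text \<open>When the square of this ad is expanded, every word without P^2 or PXP contains P X^2 P
  X^2 P.\<close>

lemma cube_absolute_zero_divisor:
  "((x \<bullet> p) \<bullet> (x \<bullet> p) \<bullet> x) \<bullet> ((x \<bullet> p) \<bullet> (x \<bullet> p) \<bullet> x) \<bullet> v = 0"
  unfolding bracket_bracket_square
  by (simp add: bracket_bracket_left bracket_linear absolute_zero_divisor sandwich
      sandwich_commute square_operator_square)

context
  fixes x
  assumes cube_eq_0: "(x \<bullet> p) \<bullet> (x \<bullet> p) \<bullet> x = 0"
begin

lemma triple_eq_0: "p \<bullet> x \<bullet> x \<bullet> x \<bullet> p = 0"
  using cube_eq_0 by (simp add: bracket_bracket_square triple_as_operator)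

text \<open>Since \<open>triple_eq_0\<close> removes the distribution with x, x, x together, three
  unknowns remain. The relations are \<open>3 ?a = 0\<close>, \<open>?a = ?b + ?c\<close> and
  \<open>?b = ?a + 2 ?c\<close>, whence \<open>3 ?c = 0\<close>.\<close>

lemma mixed_operators_eq_0:
  shows "p \<bullet> x \<bullet> x \<bullet> p \<bullet> x \<bullet> u \<bullet> p \<bullet> w = 0" (is ?A)
    and "p \<bullet> x \<bullet> u \<bullet> p \<bullet> x \<bullet> x \<bullet> p \<bullet> w = 0" (is ?B)
proof -
  let ?a = "p \<bullet> x \<bullet> x \<bullet> p \<bullet> x \<bullet> u \<bullet> w \<bullet> p"
    and ?b = "p \<bullet> x \<bullet> u \<bullet> p \<bullet> x \<bullet> x \<bullet> w \<bullet> p"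
    and ?c = "p \<bullet> x \<bullet> w \<bullet> p \<bullet> x \<bullet> x \<bullet> u \<bullet> p"
  have "?a + ?a + ?a = 0"
    using quintic_identity[of u w x x x] by (simp add: triple_eq_0)
  then have a: "?a = 0" by (rule triple_eq_0D)
  have "?a = ?b + ?c"
    using quintic_identity[of x x x u w]
    by (simp add: triple_eq_0 triple_commute_right[of x w x] triple_commute_right[of x u x]
        triple_commute_left[of w x x] triple_commute_left[of u x x])
  moreover have "?b = ?a + ?c + ?c"
    using quintic_identity[of x u x x w]
    by (simp add: triple_commute_left[of w x u] triple_commute_right[of x w u])
  ultimately have "?c + ?c + ?c = 0" and "?b = ?c + ?c"
    using a by simp_all
  then have b: "?b = 0" using triple_eq_0D[of ?c] by simp
  show ?A using a by (simp add: triple_as_operator bracket_linear)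
  show ?B using b by (simp add: triple_as_operator bracket_linear)
qed

text \<open>Redistributing the letters u, u, x, x, w behind the leading P X^2 makes each term begin
  with P X^2 P X^2 P or P X^2 P X W P, both zero.\<close>

lemma square_operator_sandwich: "p \<bullet> x \<bullet> x \<bullet> p \<bullet> u \<bullet> u \<bullet> p \<bullet> x \<bullet> x \<bullet> p \<bullet> w = 0"
proof -
  have "p \<bullet> x \<bullet> x \<bullet> p \<bullet> u \<bullet> u \<bullet> p \<bullet> x \<bullet> x \<bullet> w \<bullet> p = 0"
    unfolding quintic_identity[of u u x x w]
    by (simp add: bracket_linear mixed_operators_eq_0 square_operator_square)
  then show ?thesis
    by (simp add: triple_as_operator bracket_linear)
qed

text \<open>Up to \<open>sandwich_commute\<close>, the words surviving \<open>sandwich\<close>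
  contain P X^2 P X U P, P X U P X^2 P or P X^2 P U^2 P X^2 P.\<close>

lemma square_absolute_zero_divisor:
  "((x \<bullet> p) \<bullet> (x \<bullet> p) \<bullet> u) \<bullet> ((x \<bullet> p) \<bullet> (x \<bullet> p) \<bullet> u) \<bullet> v = 0"
  unfolding bracket_bracket_square
  by (simp add: bracket_bracket_left bracket_linear absolute_zero_divisor sandwich
      sandwich_commute[of u x] square_operator_square mixed_operators_eq_0 square_operator_sandwich)

end

end

theorem proposition2p4:
  fixes scale :: "'k::comm_ring_1 \<Rightarrow> 'q::ab_group_add \<Rightarrow> 'q"
    and bracket :: "'q \<Rightarrow> 'q \<Rightarrow> 'q"
    and Q :: "'g::ab_group_add \<Rightarrow> 'q set"
    and L :: "'q set"
  assumes "lie_algebra scale bracket"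
    and "\<And>a::'k. 2 * a = 0 \<Longrightarrow> a = 0" and "\<And>a::'k. 3 * a = 0 \<Longrightarrow> a = 0"
    and "\<And>q. scale 2 q = 0 \<Longrightarrow> q = 0" and "\<And>q. scale 3 q = 0 \<Longrightarrow> q = 0"
    and "lie_grading scale bracket UNIV Q"
    and "graded_subalgebra scale bracket Q L"
    and "graded_weak_algebra_of_quotients bracket Q L"
    and "graded_strongly_nondegenerate bracket L (\<lambda>\<sigma>. L \<inter> Q \<sigma>)"
  shows "graded_strongly_nondegenerate bracket UNIV Q"
  unfolding graded_strongly_nondegenerate_def
proof (rule notI, elim exE conjE)
  fix p
  assume p0: "p \<noteq> 0" and "homogeneous_absolute_zero_divisor bracket UNIV Q p"
  then obtain \<sigma> where p: "p \<in> Q \<sigma>" and azd: "\<And>v. bracket p (bracket p v) = 0"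
    unfolding homogeneous_absolute_zero_divisor_def homogeneous_elements_def by auto
  interpret lie_algebra scale bracket by fact
  interpret lie_absolute_zero_divisor scale bracket p
    by unfold_locales (fact azd assms(4,5))+
  have bracket_Q: "bracket a b \<in> Q (\<rho> + \<tau>)" if "a \<in> Q \<rho>" "b \<in> Q \<tau>" for a b \<rho> \<tau>
    using assms(6) that unfolding lie_grading_def by blast
  have bracket_L: "bracket a b \<in> L" if "a \<in> L" "b \<in> L" for a b
    using assms(7) that unfolding graded_subalgebra_def lie_subalgebra_def by blast
  have nondegenerate: "a = 0"
    if "a \<in> L" "a \<in> Q \<rho>" "\<And>v. v \<in> L \<Longrightarrow> bracket a (bracket a v) = 0" for a \<rho>
    using assms(9) that
    unfolding graded_strongly_nondegenerate_def homogeneous_absolute_zero_divisor_def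
      homogeneous_elements_def by blast
  obtain \<alpha> x where x: "x \<in> L" "x \<in> Q \<alpha>" and y0: "bracket x p \<noteq> 0" and yL: "bracket x p \<in> L"
    using assms(8) p p0 unfolding graded_weak_algebra_of_quotients_def by blast
  define y where "y = bracket x p"
  have y: "y \<in> L" "y \<in> Q (\<alpha> + \<sigma>)"
    using yL bracket_Q[OF x(2) p] by (simp_all add: y_def)
  have yyL: "bracket y (bracket y u) \<in> L" if "u \<in> L" for u
    using bracket_L y(1) that by blast
  have yyQ: "bracket y (bracket y u) \<in> Q (\<alpha> + \<sigma> + (\<alpha> + \<sigma> + \<tau>))" if "u \<in> Q \<tau>" for u \<tau>
    by (intro bracket_Q y(2) that)
  \<comment> \<open>The square of the ad vanishes on all of the algebra, in particular on
    \<open>L\<close>.\<close>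
  have cube: "bracket y (bracket y x) = 0"
    by (rule nondegenerate[OF yyL yyQ, OF x]) (unfold y_def, rule cube_absolute_zero_divisor)
  \<comment> \<open>\<open>cube\<close> supplies the assumption \<open>cube_eq_0\<close>;
    \<open>u\<close> is homogeneous so that \<open>yyQ\<close> places [y,[y,u]] in a single
    degree.\<close>
  have homogeneous: "bracket y (bracket y u) = 0" if u: "u \<in> L" "u \<in> Q \<tau>" for u \<tau>
    by (rule nondegenerate[OF yyL yyQ, OF u])
      (unfold y_def, rule square_absolute_zero_divisor[OF cube[unfolded y_def]])
  \<comment> \<open>Linearity extends \<open>homogeneous\<close> to arbitrary \<open>v\<close>, as
    the final use of \<open>nondegenerate\<close> requires.\<close>
  have "bracket y (bracket y v) = 0" if "v \<in> L" for v
  proof -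
    have "\<exists>!f. (\<forall>\<tau>. f \<tau> \<in> L \<inter> Q \<tau>) \<and> finite {\<tau>. f \<tau> \<noteq> 0} \<and> v = (\<Sum>\<tau> | f \<tau> \<noteq> 0. f \<tau>)"
      using assms(7) that unfolding graded_subalgebra_def is_direct_sum_def by simp
    from ex1_implies_ex[OF this] obtain f
      where f: "\<And>\<tau>. f \<tau> \<in> L \<inter> Q \<tau>" and v: "v = (\<Sum>\<tau> | f \<tau> \<noteq> 0. f \<tau>)"
      by blast
    have "bracket y (bracket y v) = (\<Sum>\<tau> | f \<tau> \<noteq> 0. bracket y (bracket y (f \<tau>)))"
      by (simp add: v bracket_sum_right)
    also have "\<dots> = 0"
      using f by (intro sum.neutral ballI homogeneous) auto
    finally show ?thesis .
  qed
  then have "y = 0"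
    by (rule nondegenerate[OF y])
  then show False
    using y0 by (simp add: y_def)
qed

end
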